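(* For every $\varepsilon > 0$ there exists a set $A \subseteq \mathbb{N}$ with $d^*(A) > 1 - \varepsilon$ such that whenever $B \subseteq \mathbb{N}$ and $t \in \mathbb{Z}$ satisfy $$\{b_1 b_2 + b_3 + t : b_1, b_2, b_3 \in B,\ b_1 < b_2 < b_3\} \subseteq A,$$ the set $B$ is finite.
   Context: $\mathbb{N} = \{1,2,3,\dots\}$. $d^*$ denotes the (additive) upper Banach density of a subset of $\mathbb{N}$: $d^*(A) = \lim_{N\to\infty} \sup_{M \ge 0} |A \cap \{M+1, \dots, M+N\}|/N$. *)

theory Defs
  imports "HOL-Analysis.Analysis"
begin

text \<open>
  The limit below exists for every \<open>A\<close>: the numerators
  \<open>SUP M. card (A \<inter> {M+1..M+N})\<close> are subadditive in \<open>N\<close>.  Only values at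
  positive integers matter, so whether \<open>0 \<in> A\<close> is irrelevant.
\<close>

definition upper_Banach_density :: "nat set \<Rightarrow> real" where
  "upper_Banach_density A =
     lim (\<lambda>N. SUP M. real (card (A \<inter> {M + 1..M + N})) / real N)"

end

theory Submission
  imports Defs
begin

text \<open>
  An infinite \<open>B\<close> has infinitely many elements in some residue class \<open>r\<close> modulo \<open>q\<close>, and on these
  \<open>b\<^sub>1 b\<^sub>2 + b\<^sub>3 + t \<equiv> r\<^sup>2 + r + t\<close>.  The symmetry \<open>r \<mapsto> -1 - r\<close> shows that \<open>r\<^sup>2 + r\<close> takes only
  \<open>(p + 1) / 2\<close> values modulo an odd \<open>p\<close>, so by the Chinese remainder theorem it takes an
  arbitrarily small proportion of the values modulo a product \<open>q\<close> of many pairwise coprime odd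
  numbers.  For each integer \<open>t\<close> choose such a \<open>q\<close> with proportions summing to little, and remove from
  \<open>\<nat>\<close> all large \<open>n\<close> with \<open>n - t\<close> congruent to some \<open>r\<^sup>2 + r\<close> modulo \<open>q\<close>.
\<close>

section \<open>The limit defining the upper Banach density\<close>

lemma subadditive_mult_le:
  fixes u :: "nat \<Rightarrow> real"
  assumes sub: "\<And>m n. u (m + n) \<le> u m + u n"
  shows "u (k * m + r) \<le> real k * u m + u r"
proof (induction k)
  case (Suc k)
  have "u (Suc k * m + r) \<le> u m + u (k * m + r)"
    using sub[of m "k * m + r"] by (simp add: add.assoc)
  then show ?case using Suc by (simp add: algebra_simps)
qed simp

text \<open>Fekete's lemma: division with remainder by a fixed \<open>m\<close> bounds
  \<open>u n / real n\<close> by \<open>u m / real m\<close> plus a term of order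
  \<open>1 / n\<close>. Nonnegativity makes the infimum \<open>L\<close> a real number.\<close>

lemma fekete_convergent:
  fixes u :: "nat \<Rightarrow> real"
  assumes sub: "\<And>m n. u (m + n) \<le> u m + u n" and nonneg: "\<And>n. 0 \<le> u n"
  shows "convergent (\<lambda>n. u n / real n)"
proof -
  define L where "L = (INF n\<in>{1..}. u n / real n)"
  have bdd: "bdd_below ((\<lambda>n. u n / real n) ` {1..})"
    by (rule bdd_belowI2[of _ 0]) (simp add: nonneg)
  have "(\<lambda>n. u n / real n) \<longlonglongrightarrow> L"
  proof (rule LIMSEQ_I)
    fix e :: real
    assume e: "0 < e"
    \<comment> \<open>\<open>m\<close> nearly attains the infimum; \<open>C\<close> then bounds
      every remainder term \<open>u (n mod m)\<close> uniformly in \<open>n\<close>.\<close>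
    obtain m where m: "m \<ge> 1" "u m / real m < L + e / 2"
      using cINF_less_iff[OF _ bdd, of "L + e / 2"] e by (auto simp: L_def)
    define C where "C = (\<Sum>r<m. u r)"
    obtain N0 :: nat where N0: "2 * C / e < real N0"
      using reals_Archimedean2 by blast
    have "norm (u n / real n - L) < e" if n: "n \<ge> max 1 N0" for n
    proof -
      have pos: "real n > 0" using n by simp
      have "u n \<le> real (n div m) * u m + u (n mod m)"
        using subadditive_mult_le[of u "n div m" m "n mod m", OF sub] by simp
      also have "u (n mod m) \<le> C"
        unfolding C_def using m nonneg by (intro member_le_sum) auto
      also have "real (n div m) * u m \<le> real n / real m * u m"
        using nonneg of_nat_div_le_of_nat[of n m] by (intro mult_right_mono) auto
      finally have "u n / real n \<le> (real n / real m * u m + C) / real n"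
        using pos by (simp add: divide_right_mono)
      also have "\<dots> = u m / real m + C / real n"
        using pos by (simp add: add_divide_distrib)
      also have "C / real n < e / 2"
      proof -
        have "2 * C / e < real n" using N0 n by linarith
        then show ?thesis using pos e by (simp add: field_simps)
      qed
      finally have "u n / real n < L + e" using m(2) by linarith
      moreover have "L \<le> u n / real n"
        unfolding L_def using n by (intro cINF_lower bdd) auto
      ultimately show ?thesis by simp
    qed
    then show "\<exists>no. \<forall>n\<ge>no. norm (u n / real n - L) < e" by blast
  qed
  then show ?thesis by (rule convergentI)
qed

lemma bdd_above_window_density:
  "bdd_above (range (\<lambda>M. real (card (A \<inter> {M + 1..M + N})) / real N))"
proof (rule bdd_aboveI2[of _ _ 1])
  fix M
  have "card (A \<inter> {M + 1..M + N}) \<le> card {M + 1..M + N}"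
    by (rule card_mono) auto
  then show "real (card (A \<inter> {M + 1..M + N})) / real N \<le> 1"
    by (cases "N = 0") simp_all
qed

text \<open>Nothing can be proved about \<open>lim\<close> before convergence is known. A window of
  length \<open>m + n\<close> splits into two adjacent windows, so the largest count
  \<open>real N * g N\<close> is subadditive and Fekete's lemma applies.\<close>

lemma convergent_window_density:
  "convergent (\<lambda>N. SUP M. real (card (A \<inter> {M + 1..M + N})) / real N)"
proof -
  define g where "g = (\<lambda>N. SUP M. real (card (A \<inter> {M + 1..M + N})) / real N)"
  have card_le: "real (card (A \<inter> {M + 1..M + N})) \<le> real N * g N" for M N
  proof (cases "N = 0")
    case False
    have "real (card (A \<inter> {M + 1..M + N})) / real N \<le> g N"
      unfolding g_def by (rule cSUP_upper[OF _ bdd_above_window_density]) simp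
    then show ?thesis using False by (simp add: field_simps)
  qed simp
  have g_nonneg: "0 \<le> real N * g N" for N
    using card_le[of 0 N] of_nat_0_le_iff[of "card (A \<inter> {0 + 1..0 + N})"] by (rule order_trans[rotated])
  have sub: "real (m + n) * g (m + n) \<le> real m * g m + real n * g n" for m n
  proof (cases "m + n = 0")
    case False
    have "g (m + n) \<le> (real m * g m + real n * g n) / real (m + n)"
    proof (subst (1) g_def, rule cSUP_least)
      fix M
      have "A \<inter> {M + 1..M + (m + n)} = (A \<inter> {M + 1..M + m}) \<union> (A \<inter> {(M + m) + 1..(M + m) + n})"
        by auto
      then have "card (A \<inter> {M + 1..M + (m + n)})
          \<le> card (A \<inter> {M + 1..M + m}) + card (A \<inter> {(M + m) + 1..(M + m) + n})"
        by (simp only: card_Un_le)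
      then have "real (card (A \<inter> {M + 1..M + (m + n)})) \<le> real m * g m + real n * g n"
        using card_le[of M m] card_le[of "M + m" n] by linarith
      then show "real (card (A \<inter> {M + 1..M + (m + n)})) / real (m + n)
          \<le> (real m * g m + real n * g n) / real (m + n)"
        by (rule divide_right_mono) simp
    qed simp
    then show ?thesis using False by (simp add: field_simps)
  qed simp
  have "convergent (\<lambda>N. real N * g N / real N)"
    by (rule fekete_convergent[OF sub g_nonneg])
  \<comment> \<open>The factor \<open>real N\<close> cancels only for positive \<open>N\<close>,
    hence the shift by one and back.\<close>
  then have "convergent (\<lambda>N. real (Suc N) * g (Suc N) / real (Suc N))"
    by (subst (asm) convergent_Suc_iff[symmetric])
  then have "convergent (\<lambda>N. g (Suc N))" by (simp del: of_nat_Suc)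
  then have "convergent g" by (subst (asm) convergent_Suc_iff)
  then show ?thesis unfolding g_def .
qed

text \<open>The window at \<open>M = 0\<close> is one competitor in the supremum, so counting in
  initial segments suffices.\<close>

lemma upper_Banach_density_ge:
  assumes "\<And>N. N \<ge> 1 \<Longrightarrow> c * real N \<le> real (card (A \<inter> {1..N}))"
  shows "c \<le> upper_Banach_density A"
  unfolding upper_Banach_density_def
proof (rule LIMSEQ_le_const)
  show "(\<lambda>N. SUP M. real (card (A \<inter> {M + 1..M + N})) / real N) \<longlonglongrightarrow>
      lim (\<lambda>N. SUP M. real (card (A \<inter> {M + 1..M + N})) / real N)"
    using convergent_window_density by (simp only: convergent_LIMSEQ_iff)
  have "c \<le> (SUP M. real (card (A \<inter> {M + 1..M + N})) / real N)" if "N \<ge> 1" for N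
  proof -
    have "c \<le> real (card (A \<inter> {0 + 1..0 + N})) / real N"
      using assms[OF that] that by (simp add: field_simps)
    also have "\<dots> \<le> (SUP M. real (card (A \<inter> {M + 1..M + N})) / real N)"
      by (rule cSUP_upper[OF _ bdd_above_window_density]) simp
    finally show ?thesis .
  qed
  then show "\<exists>N. \<forall>n\<ge>N. c \<le> (SUP M. real (card (A \<inter> {M + 1..M + n})) / real n)" by blast
qed

section \<open>Values of \<open>r\<^sup>2 + r\<close> modulo \<open>q\<close>\<close>

text \<open>Pronic numbers are those of the form \<open>r * (r + 1)\<close>. Working over the
  integers makes the reflection of \<open>r\<close> and the subtraction of a negative
  \<open>t\<close> unproblematic.\<close>

definition pronic_residues :: "nat \<Rightarrow> int set" where
  "pronic_residues q = range (\<lambda>r::int. (r * r + r) mod int q)"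

lemma pronic_residues_subset: "q > 0 \<Longrightarrow> pronic_residues q \<subseteq> {0..<int q}"
  by (auto simp: pronic_residues_def)

lemma finite_pronic_residues: "q > 0 \<Longrightarrow> finite (pronic_residues q)"
  using pronic_residues_subset finite_subset by blast

lemma card_pronic_residues_odd:
  assumes "odd p"
  shows "card (pronic_residues p) \<le> (p + 1) div 2"
proof -
  let ?f = "\<lambda>r::int. (r * r + r) mod int p"
  obtain h where h: "p = 2 * h + 1" using assms oddE by blast
  have "pronic_residues p \<subseteq> ?f ` {0..int h}"
  proof -
    have "?f r \<in> ?f ` {0..int h}" for r
    proof -
      define s where "s = r mod int p"
      have s: "0 \<le> s" "s < int p" using h by (auto simp: s_def)
      have rs: "?f r = ?f s" unfolding s_def by (rule mod_add_cong[OF mod_mult_cong]) simp_all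
      show ?thesis
      proof (cases "s \<le> int h")
        case True
        then show ?thesis using s rs by auto
      next
        case False
        \<comment> \<open>The reflection of \<open>s\<close> to \<open>-1 - s\<close>, shifted by
          \<open>p\<close> to stay among the representatives; it sends the upper half into
          \<open>{0..int h}\<close>.\<close>
        have "(int p - 1 - s) * (int p - 1 - s) + (int p - 1 - s)
            = s * s + s + int p * (int p - 1 - 2 * s)"
          by (simp add: algebra_simps)
        then have "?f (int p - 1 - s) = ?f s" by (simp only: mod_mult_self2)
        moreover have "int p - 1 - s \<in> {0..int h}" using False s h by auto
        ultimately show ?thesis
          unfolding rs by (intro image_eqI[of _ _ "int p - 1 - s"]) (rule sym)
      qed
    qed
    then show ?thesis by (auto simp: pronic_residues_def)
  qed
  then have "card (pronic_residues p) \<le> card (?f ` {0..int h})" by (intro card_mono) auto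
  also have "\<dots> \<le> card {0..int h}" by (rule card_image_le) simp
  finally show ?thesis using h by simp
qed

text \<open>Chinese remainder theorem: reducing modulo \<open>p\<close> and modulo \<open>q\<close>
  is injective on residues modulo \<open>p * q\<close> and preserves the form
  \<open>r * r + r\<close>.\<close>

lemma card_pronic_residues_mult:
  assumes "coprime p q" "p > 0" "q > 0"
  shows "card (pronic_residues (p * q)) \<le> card (pronic_residues p) * card (pronic_residues q)"
proof -
  let ?g = "\<lambda>x::int. (x mod int p, x mod int q)"
  have "inj_on ?g (pronic_residues (p * q))"
  proof (rule inj_onI)
    fix x y
    assume "x \<in> pronic_residues (p * q)" "y \<in> pronic_residues (p * q)" and eq: "?g x = ?g y"
    then have xy: "x mod int (p * q) = x" "y mod int (p * q) = y"
      by (auto simp: pronic_residues_def)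
    have "int p dvd x - y" "int q dvd x - y" using eq by (auto simp: mod_eq_dvd_iff)
    then have "int (p * q) dvd x - y"
      using assms(1) by (simp add: divides_mult)
    then show "x = y" using xy by (metis mod_eq_dvd_iff)
  qed
  moreover have "?g ` pronic_residues (p * q) \<subseteq> pronic_residues p \<times> pronic_residues q"
    by (auto simp: pronic_residues_def mod_mod_cancel)
  ultimately have "card (pronic_residues (p * q)) \<le> card (pronic_residues p \<times> pronic_residues q)"
    using assms finite_pronic_residues by (intro card_inj_on_le[of ?g]) auto
  then show ?thesis by (simp add: card_cartesian_product)
qed

lemma pronic_residues_geometric:
  "\<exists>q. odd q \<and> real (card (pronic_residues q)) \<le> (2 / 3) ^ k * real q"
proof (induction k)
  case 0
  have "card (pronic_residues 1) \<le> 1" using card_pronic_residues_odd[of 1] by simp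
  then show ?case by (intro exI[of _ 1]) simp
next
  case (Suc k)
  then obtain q where q: "odd q" "real (card (pronic_residues q)) \<le> (2 / 3) ^ k * real q" by blast
  \<comment> \<open>A new odd factor that is automatically coprime to \<open>q\<close>, as
    \<open>gcd (q + 2) q = gcd 2 q = 1\<close>.\<close>
  define p where "p = q + 2"
  have p: "odd p" "p \<ge> 3" using q(1) odd_pos[OF q(1)] by (auto simp: p_def)
  have "coprime p q"
  proof -
    have "gcd p q = gcd 2 q" unfolding p_def by (subst add.commute) (rule gcd_add1)
    moreover have "coprime 2 q" using q(1) by simp
    ultimately show ?thesis unfolding coprime_iff_gcd_eq_1 by metis
  qed
  then have "card (pronic_residues (p * q)) \<le> card (pronic_residues p) * card (pronic_residues q)"
    using p q(1) by (intro card_pronic_residues_mult) (auto intro: odd_pos)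
  then have "real (card (pronic_residues (p * q)))
      \<le> real (card (pronic_residues p)) * real (card (pronic_residues q))"
    by (metis of_nat_le_iff of_nat_mult)
  also have "\<dots> \<le> (2 / 3 * real p) * ((2 / 3) ^ k * real q)"
  proof (rule mult_mono[OF _ q(2)])
    \<comment> \<open>The ratio \<open>2 / 3\<close> comes from
      \<open>(p + 1) / 2 \<le> 2 * p / 3\<close>, which holds exactly when
      \<open>p \<ge> 3\<close>.\<close>
    have "3 * card (pronic_residues p) \<le> 2 * p"
      using card_pronic_residues_odd[OF p(1)] p(2) by linarith
    then show "real (card (pronic_residues p)) \<le> 2 / 3 * real p" by linarith
  qed auto
  also have "\<dots> = (2 / 3) ^ Suc k * real (p * q)" by simp
  finally show ?case using p q by (intro exI[of _ "p * q"]) simp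
qed

lemma pronic_residues_sparse:
  assumes "(0::real) < \<delta>"
  shows "\<exists>q>0. real (card (pronic_residues q)) \<le> \<delta> * real q"
proof -
  obtain k where "(2 / 3 :: real) ^ k < \<delta>"
    using real_arch_pow_inv[OF assms, of "2 / 3"] by auto
  moreover obtain q where "odd q" "real (card (pronic_residues q)) \<le> (2 / 3) ^ k * real q"
    using pronic_residues_geometric by blast
  ultimately have "real (card (pronic_residues q)) \<le> \<delta> * real q"
    using mult_right_mono[of "(2 / 3) ^ k" \<delta> "real q"] by simp
  then show ?thesis using \<open>odd q\<close> odd_pos by blast
qed

section \<open>Counting and pigeonhole in residue classes\<close>

text \<open>The quotient \<open>n div q\<close> and the residue of \<open>n - t\<close> determine
  \<open>n\<close>. There are \<open>N div q + 1\<close> possible quotients, and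
  \<open>q \<le> N\<close> absorbs the extra one into the factor 2.\<close>

lemma card_residues_in_le:
  fixes S :: "int set" and t :: int
  assumes q: "0 < q" "q \<le> N" and S: "finite S" "real (card S) \<le> \<delta> * real q"
  shows "real (card {n \<in> {1..N}. (int n - t) mod int q \<in> S}) \<le> 2 * \<delta> * real N"
proof -
  let ?X = "{n \<in> {1..N}. (int n - t) mod int q \<in> S}"
  let ?g = "\<lambda>n. ((int n - t) mod int q, n div q)"
  have "inj_on ?g ?X"
  proof (rule inj_onI)
    fix x y
    assume "?g x = ?g y"
    then have "(int x - t) mod int q = (int y - t) mod int q" and dv: "x div q = y div q" by auto
    then have "int x mod int q = int y mod int q" by (simp add: mod_eq_dvd_iff)
    then have "x mod q = y mod q" by (metis of_nat_eq_iff zmod_int)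
    then show "x = y" using dv by (metis div_mult_mod_eq)
  qed
  moreover have "?g ` ?X \<subseteq> S \<times> {0..N div q}"
    by (auto intro: div_le_mono)
  ultimately have "card ?X \<le> card (S \<times> {0..N div q})"
    using S(1) by (intro card_inj_on_le[of ?g]) auto
  also have "\<dots> = card S * (N div q + 1)" by (simp add: card_cartesian_product)
  finally have "real (card ?X) \<le> real (card S) * real (N div q + 1)"
    by (metis of_nat_le_iff of_nat_mult)
  also have "\<dots> \<le> (\<delta> * real q) * (2 * real N / real q)"
  proof (rule mult_mono[OF S(2)])
    have "real (N div q) \<le> real N / real q" by (rule of_nat_div_le_of_nat)
    moreover have "1 \<le> real N / real q" using q by simp
    ultimately show "real (N div q + 1) \<le> 2 * real N / real q" by simp
    show "0 \<le> \<delta> * real q" using of_nat_0_le_iff S(2) by (rule order_trans)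
  qed simp
  also have "\<dots> = 2 * \<delta> * real N" using q by simp
  finally show ?thesis .
qed

lemma infinite_in_residue_class:
  fixes B :: "nat set"
  assumes "infinite B" "0 < q"
  obtains r where "infinite {b \<in> B. b mod q = r}"
proof -
  have "finite ((\<lambda>b. b mod q) ` B)"
    by (rule finite_subset[of _ "{..<q}"]) (use assms(2) in auto)
  then show thesis using pigeonhole_infinite[OF assms(1)] that by blast
qed

theorem theorem1p7:
  fixes \<epsilon> :: real
  assumes "\<epsilon> > 0"
  shows "\<exists>A::nat set. A \<subseteq> {1..} \<and> upper_Banach_density A > 1 - \<epsilon> \<and>
    (\<forall>(B::nat set) (t::int). B \<subseteq> {1..} \<longrightarrow>
       {int b1 * int b2 + int b3 + t | b1 b2 b3.
          b1 \<in> B \<and> b2 \<in> B \<and> b3 \<in> B \<and> b1 < b2 \<and> b2 < b3} \<subseteq> int ` A \<longrightarrow>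
       finite B)"
proof -
  \<comment> \<open>Removing proportion at most \<open>2 * \<delta> k\<close> for each
    \<open>k\<close> costs at most \<open>\<epsilon> / 2\<close> in total.\<close>
  define \<delta> where "\<delta> k = \<epsilon> / 8 * (1 / 2) ^ k" for k :: nat
  have "\<exists>q>0. real (card (pronic_residues q)) \<le> \<delta> k * real q" for k
    using assms by (intro pronic_residues_sparse) (simp add: \<delta>_def)
  then obtain q where q: "\<And>k. q k > 0"
      "\<And>k. real (card (pronic_residues (q k))) \<le> \<delta> k * real (q k)"
    by metis
  define R where "R k = {n. max k (q k) < n \<and>
      (int n - from_nat k) mod int (q k) \<in> pronic_residues (q k)}" for k
  define A where "A = {1..} - (\<Union>k. R k)"
  have "1 - \<epsilon> / 2 \<le> upper_Banach_density A"
  proof (rule upper_Banach_density_ge)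
    fix N :: nat
    assume "N \<ge> 1"
    have R_card: "real (card (R k \<inter> {1..N})) \<le> 2 * \<delta> k * real N" for k
    proof (cases "q k \<le> N")
      case True
      have "card (R k \<inter> {1..N})
          \<le> card {n \<in> {1..N}. (int n - from_nat k) mod int (q k) \<in> pronic_residues (q k)}"
        by (rule card_mono) (auto simp: R_def)
      also have "real \<dots> \<le> 2 * \<delta> k * real N"
        using True q finite_pronic_residues by (intro card_residues_in_le[of "q k"]) auto
      finally show ?thesis by simp
    next
      case False
      then have "R k \<inter> {1..N} = {}" by (auto simp: R_def)
      then show ?thesis using assms by (simp add: \<delta>_def)
    qed
    \<comment> \<open>An element of \<open>R k\<close> in \<open>{1..N}\<close> satisfies
      \<open>k < n \<le> N\<close>, so the indices below \<open>N\<close> suffice.\<close>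
    have "{1..N} = (A \<inter> {1..N}) \<union> (\<Union>k<N. R k \<inter> {1..N})"
      by (auto simp: A_def R_def)
    then have "N = card ((A \<inter> {1..N}) \<union> (\<Union>k<N. R k \<inter> {1..N}))"
      using card_atLeastAtMost[of 1 N] by simp
    also have "\<dots> \<le> card (A \<inter> {1..N}) + card (\<Union>k<N. R k \<inter> {1..N})"
      by (rule card_Un_le)
    also have "card (\<Union>k<N. R k \<inter> {1..N}) \<le> (\<Sum>k<N. card (R k \<inter> {1..N}))"
      by (rule card_UN_le) simp
    finally have "real N \<le> real (card (A \<inter> {1..N})) + (\<Sum>k<N. real (card (R k \<inter> {1..N})))"
      by (simp flip: of_nat_sum of_nat_add)
    also have "(\<Sum>k<N. real (card (R k \<inter> {1..N}))) \<le> (\<Sum>k<N. 2 * \<delta> k * real N)"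
      by (rule sum_mono) (rule R_card)
    also have "\<dots> = \<epsilon> / 4 * real N * (\<Sum>k<N. (1 / 2) ^ k)"
      by (simp add: \<delta>_def sum_distrib_left mult_ac)
    also have "\<dots> \<le> \<epsilon> / 4 * real N * 2"
      using assms by (intro mult_left_mono) (auto simp: sum_gp_strict)
    finally show "(1 - \<epsilon> / 2) * real N \<le> real (card (A \<inter> {1..N}))"
      by (simp add: algebra_simps)
  qed
  then have "upper_Banach_density A > 1 - \<epsilon>" using assms by linarith
  moreover have "finite B"
    if sub: "{int b1 * int b2 + int b3 + t | b1 b2 b3.
        b1 \<in> B \<and> b2 \<in> B \<and> b3 \<in> B \<and> b1 < b2 \<and> b2 < b3} \<subseteq> int ` A"
    for B :: "nat set" and t :: int
  proof (rule ccontr)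
    assume inf: "infinite B"
    \<comment> \<open>The index whose removed set handles this shift:
      \<open>from_nat k = t\<close>.\<close>
    define k where "k = to_nat t"
    obtain r where r: "infinite {b \<in> B. b mod q k = r}"
      using infinite_in_residue_class[OF inf q(1)] by blast
    obtain b1 where b1: "b1 \<in> B" "b1 mod q k = r"
      using r infinite_imp_nonempty by blast
    obtain b2 where b2: "b2 \<in> B" "b2 mod q k = r" "b1 < b2"
      using r unfolding infinite_nat_iff_unbounded by blast
    \<comment> \<open>\<open>b3\<close> is so large that, even for negative \<open>t\<close>, the
      resulting value exceeds the threshold \<open>max k (q k)\<close> in
      \<open>R k\<close>.\<close>
    obtain b3 where b3: "b3 \<in> B" "b3 mod q k = r" "b2 + max k (q k) + nat \<bar>t\<bar> < b3"
      using r unfolding infinite_nat_iff_unbounded by blast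
    have "int b1 * int b2 + int b3 + t \<in> int ` A"
    proof (rule subsetD[OF sub])
      have "b2 < b3" using b3(3) by linarith
      then show "int b1 * int b2 + int b3 + t \<in> {int b1 * int b2 + int b3 + t | b1 b2 b3.
          b1 \<in> B \<and> b2 \<in> B \<and> b3 \<in> B \<and> b1 < b2 \<and> b2 < b3}"
        using b1(1) b2(1,3) b3(1) by blast
    qed
    then obtain n where n: "n \<in> A" "int n = int b1 * int b2 + int b3 + t" by auto
    have "0 \<le> int b1 * int b2" by simp
    then have "max k (q k) < n" using n(2) b3(3) by linarith
    \<comment> \<open>All three elements are congruent to \<open>r\<close>, so \<open>n - t\<close>
      has a pronic residue and \<open>n\<close> was removed from \<open>A\<close>.\<close>
    moreover have "(int n - t) mod int (q k) = (int r * int r + int r) mod int (q k)"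
    proof -
      have class_eq: "int b mod int (q k) = int r mod int (q k)" if "b mod q k = r" for b
        using that by (auto simp: zmod_int)
      have "(int b1 * int b2 + int b3) mod int (q k) = (int r * int r + int r) mod int (q k)"
        using b1(2) b2(2) b3(2) by (intro mod_add_cong[OF mod_mult_cong] class_eq)
      then show ?thesis using n(2) by simp
    qed
    ultimately have "n \<in> R k" by (auto simp: R_def k_def pronic_residues_def)
    then show False using n(1) by (auto simp: A_def)
  qed
  moreover have "A \<subseteq> {1..}" by (auto simp: A_def)
  ultimately show ?thesis by (intro exI[of _ A] conjI allI impI)
qed

end
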